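(* Let $n\geq 1$ and let $$\operatorname{per}_n=\sum_{\sigma\in\mathbb{S}_n}e_{\sigma(1)}\otimes e_{\sigma(2)}\otimes\cdots\otimes e_{\sigma(n)}\in\underbrace{\mathbb{C}^n\otimes\cdots\otimes\mathbb{C}^n}_n.$$ Then $\|\operatorname{per}_n\|_\star=n^{n/2}$.
   Context: $\mathbb{S}_n$ is the symmetric group on $n$ letters and $e_1,\dots,e_n$ is the standard orthonormal basis of $\mathbb{C}^n$. For a tensor product $V=V^{(1)}\otimes\cdots\otimes V^{(d)}$ of finite dimensional Hilbert spaces (with the induced Hermitian form), a pure tensor is an element of the form $v^{(1)}\otimes\cdots\otimes v^{(d)}$ with $v^{(e)}\in V^{(e)}$. The nuclear norm $\|T\|_\star$ of $T\in V$ is the smallest possible value of $\sum_{i=1}^m\|v_i\|$ over all decompositions $T=\sum_{i=1}^m v_i$ ($m$ arbitrary) into pure tensors. *)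

theory Defs
  imports "HOL-Analysis.Analysis" "HOL-Combinatorics.Permutations"
begin

text \<open>
  A tensor of order \<open>d\<close> over \<open>\<complex>\<^sup>n\<close> is given by its coordinates in the basis of all
  \<open>e\<^bsub>I(1)\<^esub> \<otimes> \<dots> \<otimes> e\<^bsub>I(d)\<^esub>\<close>, where \<open>I\<close> ranges over the multi-indices \<open>'d \<Rightarrow> 'n\<close>,
  \<open>d = CARD('d)\<close> and \<open>n = CARD('n)\<close>. This basis is orthonormal for the induced Hermitian form,
  so the induced norm is the Euclidean norm that the library puts on \<open>complex ^ ('d \<Rightarrow> 'n)\<close>
  (see \<open>tensor_hermitian\<close> and \<open>norm_tensor\<close> below).
\<close>

type_synonym ('d, 'n) tensor = "(complex, 'd \<Rightarrow> 'n) vec"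

definition tensor :: "('d::finite \<Rightarrow> complex ^ 'n::finite) \<Rightarrow> ('d, 'n) tensor" where
  "tensor v = (\<chi> I. \<Prod>k\<in>UNIV. v k $ I k)"

definition pure_tensor :: "('d::finite, 'n::finite) tensor \<Rightarrow> bool" where
  "pure_tensor t \<longleftrightarrow> (\<exists>v. t = tensor v)"

text \<open>The smallest value is always attained; \<open>LEAST\<close> denotes the minimum of the set.\<close>

definition nuclear_norm :: "('d::finite, 'n::finite) tensor \<Rightarrow> real" where
  "nuclear_norm T = (LEAST r. \<exists>(m::nat) v. (\<forall>i<m. pure_tensor (v i)) \<and>
     T = (\<Sum>i<m. v i) \<and> r = (\<Sum>i<m. norm (v i)))"

definition per :: "('n::finite, 'n) tensor" where
  "per = (\<Sum>\<sigma> | \<sigma> permutes (UNIV :: 'n set). tensor (\<lambda>k. axis (\<sigma> k) 1))"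

lemma tensor_axis: "tensor (\<lambda>k. axis (I k) 1) = axis I 1"
proof (rule vec_eq_iff[THEN iffD2], rule allI)
  fix J
  show "tensor (\<lambda>k. axis (I k) 1) $ J = axis I 1 $ J"
  proof (cases "I = J")
    case False
    then obtain k where "I k \<noteq> J k" by blast
    then have "(\<Prod>k\<in>UNIV. axis (I k) (1::complex) $ J k) = 0"
      by (intro prod_zero) (auto simp: axis_def intro!: exI[of _ k])
    with False show ?thesis by (simp add: tensor_def axis_def)
  qed (simp add: tensor_def axis_def)
qed

lemma tensor_hermitian:
  "(\<Sum>I\<in>UNIV. tensor v $ I * cnj (tensor w $ I)) = (\<Prod>k\<in>UNIV. \<Sum>i\<in>UNIV. v k $ i * cnj (w k $ i))"
proof -
  have "(\<Prod>k\<in>UNIV. \<Sum>i\<in>UNIV. v k $ i * cnj (w k $ i))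
      = (\<Sum>I\<in>UNIV \<rightarrow>\<^sub>E UNIV. \<Prod>k\<in>UNIV. v k $ I k * cnj (w k $ I k))"
    by (subst prod_sum_PiE) auto
  then show ?thesis
    by (simp add: tensor_def PiE_UNIV_domain prod.distrib cnj_prod)
qed

lemma norm_tensor: "norm (tensor v) = (\<Prod>k\<in>UNIV. norm (v k))"
proof -
  have norm_sq: "complex_of_real ((norm x)\<^sup>2) = (\<Sum>i\<in>UNIV. x $ i * cnj (x $ i))"
    for x :: "complex ^ 'm::finite"
    by (simp add: norm_vec_def L2_set_def sum_nonneg complex_norm_square del: of_real_power)
  have "complex_of_real ((norm (tensor v))\<^sup>2) = complex_of_real (\<Prod>k\<in>UNIV. (norm (v k))\<^sup>2)"
    by (simp only: norm_sq tensor_hermitian of_real_prod)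
  then have "(norm (tensor v))\<^sup>2 = (\<Prod>k\<in>UNIV. norm (v k))\<^sup>2"
    by (simp only: of_real_eq_iff prod_power_distrib)
  then show ?thesis by (simp add: prod_nonneg)
qed

end

theory Submission imports Defs begin

text \<open>
  Upper bound: Glynn's formula writes \<open>per\<close> as the average over all sign vectors \<open>\<delta>\<close> of
  \<open>\<delta>\<^sub>1\<dots>\<delta>\<^sub>n \<cdot> \<delta> \<otimes> \<dots> \<otimes> \<delta>\<close>, and each of these tensors has norm \<open>n\<^bsup>n/2\<^esup>\<close>.

  Lower bound: pairing a decomposition with \<open>per\<close>, whose square norm is \<open>n!\<close>, reduces the claim
  to the inequality \<open>|perm A| \<le> n!/n\<^bsup>n/2\<^esup> \<cdot> \<Prod>\<parallel>a\<^sub>k\<parallel>\<close> of Carlen, Lieb and Loss, where \<open>a\<^sub>k\<close> are the rows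
  of \<open>A\<close>. The entries may be taken nonnegative and the rows of unit length. As in Banach's theorem on
  symmetric multilinear forms, replacing two rows \<open>x, y\<close> of a maximizer by two copies of
  \<open>(x+y)/|x+y|\<close> gives another maximizer. For distinct rows this makes the sum of all rows longer, so
  the maximizer whose row sum is longest has equal rows; for equal rows the inequality is AM-GM.
\<close>

section \<open>Multilinearity and symmetry of the permanent\<close>

definition permanent :: "('n::finite \<Rightarrow> real ^ 'n) \<Rightarrow> real" where
  "permanent w = (\<Sum>\<sigma> | \<sigma> permutes (UNIV :: 'n set). \<Prod>k\<in>UNIV. w k $ \<sigma> k)"

definition nonneg_unit_rows :: "(real ^ 'n ^ 'n::finite) set" where
  "nonneg_unit_rows = {w. \<forall>k. norm (w $ k) = 1 \<and> (\<forall>i. 0 \<le> w $ k $ i)}"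

text \<open>\<open>g\<close> depends on the index so that one splitting serves both the entries
  \<open>y $ \<sigma> j\<close> in a permanent and the norms of the rows.\<close>

lemma prod_fun_upd:
  fixes w :: "'n::finite \<Rightarrow> 'a" and g :: "'n \<Rightarrow> 'a \<Rightarrow> real"
  shows "(\<Prod>j\<in>UNIV. g j ((w(k := x)) j)) = g k x * (\<Prod>j\<in>UNIV - {k}. g j (w j))"
proof -
  have "(\<Prod>j\<in>UNIV. g j ((w(k := x)) j))
      = g k ((w(k := x)) k) * (\<Prod>j\<in>UNIV - {k}. g j ((w(k := x)) j))"
    by (rule prod.remove) auto
  also have "(\<Prod>j\<in>UNIV - {k}. g j ((w(k := x)) j)) = (\<Prod>j\<in>UNIV - {k}. g j (w j))"
    by (intro prod.cong) auto
  finally show ?thesis by simp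
qed

text \<open>The cofactor of \<open>x $ \<sigma> k\<close> does not involve row \<open>k\<close>, so
  linearity in that row can be read off.\<close>

lemma permanent_fun_upd:
  "permanent (w(k := x)) =
    (\<Sum>\<sigma> | \<sigma> permutes UNIV. x $ \<sigma> k * (\<Prod>j\<in>UNIV - {k}. w j $ \<sigma> j))"
  unfolding permanent_def
  by (intro sum.cong refl prod_fun_upd[where g = "\<lambda>j y. y $ _ j"])

lemma permanent_add: "permanent (w(k := x + y)) = permanent (w(k := x)) + permanent (w(k := y))"
  unfolding permanent_fun_upd by (simp add: distrib_right sum.distrib)

lemma permanent_diff: "permanent (w(k := x - y)) = permanent (w(k := x)) - permanent (w(k := y))"
  unfolding permanent_fun_upd by (simp add: left_diff_distrib sum_subtractf)

lemma permanent_scaleR: "permanent (w(k := c *\<^sub>R x)) = c * permanent (w(k := x))"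
  unfolding permanent_fun_upd by (simp add: sum_distrib_left mult.assoc)

lemma permanent_permute_rows:
  assumes p: "p permutes UNIV"
  shows "permanent (w \<circ> p) = permanent w"
proof -
  have "permanent w = (\<Sum>\<sigma> | \<sigma> permutes UNIV. \<Prod>k\<in>UNIV. w (p k) $ \<sigma> (p k))"
    unfolding permanent_def
    by (intro sum.cong refl prod.reindex_bij_betw[OF permutes_imp_bij[OF p], symmetric])
  also have "\<dots> = permanent (w \<circ> p)"
    unfolding permanent_def
    by (subst (2) sum_permutations_compose_right[OF p]) simp
  finally show ?thesis by simp
qed

lemma abs_permanent_le: "\<bar>permanent w\<bar> \<le> permanent (\<lambda>k. \<chi> i. \<bar>w k $ i\<bar>)"
  unfolding permanent_def by (rule order_trans[OF sum_abs]) (simp add: abs_prod)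

lemma permanent_scaleR_rows: "permanent (\<lambda>k. c k *\<^sub>R w k) = (\<Prod>k\<in>UNIV. c k) * permanent w"
  by (simp add: permanent_def prod.distrib sum_distrib_left)

section \<open>Reduction to nonnegative unit rows\<close>

lemma compact_nonneg_unit_rows: "compact nonneg_unit_rows"
proof (rule compact_eq_bounded_closed[THEN iffD2], rule conjI)
  show "bounded (nonneg_unit_rows :: (real ^ 'n ^ 'n) set)"
  proof (rule boundedI)
    fix w :: "real ^ 'n ^ 'n" assume "w \<in> nonneg_unit_rows"
    then have "(\<Sum>k\<in>UNIV. norm (w $ k)) = real CARD('n)"
      by (simp add: nonneg_unit_rows_def)
    then show "norm w \<le> real CARD('n)"
      using L2_set_le_sum[of UNIV "\<lambda>k. norm (w $ k)"] by (simp add: norm_vec_def)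
  qed
  show "closed (nonneg_unit_rows :: (real ^ 'n ^ 'n) set)"
    unfolding nonneg_unit_rows_def
    by (intro closed_Collect_all closed_Collect_conj closed_Collect_eq closed_Collect_le continuous_intros)
qed

lemma nonneg_unit_rows_nonempty: "nonneg_unit_rows \<noteq> {}"
proof -
  have "(\<chi> k. axis k 1) \<in> nonneg_unit_rows"
    by (simp add: nonneg_unit_rows_def axis_def norm_axis_1[unfolded axis_def])
  then show ?thesis by blast
qed

lemma continuous_on_permanent: "continuous_on S (\<lambda>w. permanent (($) w))"
  unfolding permanent_def by (intro continuous_intros)

text \<open>Both sides are homogeneous in each row, so the rows can be normalized after passing to
  absolute values. \<open>M\<close> stays arbitrary: it is first the maximum over
  \<open>nonneg_unit_rows\<close>, later the explicit AM-GM value.\<close>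

lemma abs_permanent_le_norms:
  fixes w :: "'n::finite \<Rightarrow> real ^ 'n"
  assumes M: "\<And>w :: real ^ 'n ^ 'n. w \<in> nonneg_unit_rows \<Longrightarrow> permanent (($) w) \<le> M"
  shows "\<bar>permanent w\<bar> \<le> M * (\<Prod>k\<in>UNIV. norm (w k))"
proof (cases "\<exists>k. w k = 0")
  case True
  then obtain k where k: "w k = 0" by blast
  have "permanent (w(k := 0 *\<^sub>R 0)) = 0" unfolding permanent_scaleR by simp
  moreover have "w(k := 0 *\<^sub>R 0) = w" using k by auto
  moreover have "(\<Prod>k\<in>UNIV. norm (w k)) = 0" using k by (intro prod_zero) auto
  ultimately show ?thesis by (simp only: abs_zero mult_zero_right order_refl)
next
  case False
  define a :: "'n \<Rightarrow> real ^ 'n" where "a k = (\<chi> i. \<bar>w k $ i\<bar>)" for k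
  have na: "norm (a k) = norm (w k)" for k by (simp add: a_def norm_vec_def)
  define u :: "real ^ 'n ^ 'n" where "u = (\<chi> k. (1 / norm (w k)) *\<^sub>R a k)"
  have "u \<in> nonneg_unit_rows"
    using False by (simp add: nonneg_unit_rows_def u_def na) (simp add: a_def)
  then have "permanent (($) u) \<le> M" by (rule M)
  moreover have "a k = norm (w k) *\<^sub>R u $ k" for k using False by (simp add: u_def)
  then have "permanent a = permanent (\<lambda>k. norm (w k) *\<^sub>R u $ k)" by metis
  then have "permanent a = (\<Prod>k\<in>UNIV. norm (w k)) * permanent (($) u)"
    by (simp only: permanent_scaleR_rows)
  ultimately have "permanent a \<le> M * (\<Prod>k\<in>UNIV. norm (w k))"
    by (simp add: mult.commute mult_right_mono prod_nonneg)
  then show ?thesis using abs_permanent_le[of w, folded a_def] by linarith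
qed

section \<open>Equal rows as the extremal case\<close>

text \<open>AM-GM for the squares of the entries, whose sum is 1, bounds the product of the entries
  by n^(-n/2); each of the n! permutations contributes this product.\<close>

lemma permanent_const_row_le:
  fixes u :: "real ^ 'n::finite"
  assumes "norm u = 1" and nonneg: "\<And>i. 0 \<le> u $ i"
  shows "permanent (\<lambda>_. u) \<le> fact CARD('n) / sqrt (real CARD('n)) ^ CARD('n)"
proof -
  let ?n = "CARD('n)" and ?P = "\<Prod>i\<in>UNIV. u $ i"
  have n: "0 < ?n" by simp
  have P: "0 \<le> ?P" by (simp add: nonneg prod_nonneg)
  have sq: "(\<Sum>i\<in>UNIV. (u $ i)\<^sup>2) = 1"
    using assms(1) by (simp add: norm_vec_def L2_set_def)
  have "(\<Prod>i\<in>UNIV. (u $ i)\<^sup>2) powr (1 / ?n) \<le> (\<Sum>i\<in>UNIV. (u $ i)\<^sup>2 / ?n)"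
    by (rule arith_geom_mean) auto
  also have "\<dots> = 1 / ?n" by (simp add: sq flip: sum_divide_distrib)
  finally have "((?P\<^sup>2) powr (1 / ?n)) ^ ?n \<le> (1 / ?n) ^ ?n"
    by (intro power_mono) (auto simp: prod_power_distrib)
  moreover have "((?P\<^sup>2) powr (1 / ?n)) ^ ?n = ?P\<^sup>2"
    using n by (cases "?P = 0") (simp_all add: powr_power del: prod_zero_iff)
  ultimately have "?P\<^sup>2 \<le> ((1 / sqrt ?n) ^ ?n)\<^sup>2"
    by (simp add: power_divide power2_eq_square flip: power_mult_distrib)
  then have "?P \<le> (1 / sqrt ?n) ^ ?n"
    by (rule power2_le_imp_le) auto
  moreover have "permanent (\<lambda>_. u) = fact ?n * ?P"
  proof -
    have "(\<Prod>k\<in>UNIV. u $ \<sigma> k) = ?P" if "\<sigma> permutes UNIV" for \<sigma>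
      by (rule prod.reindex_bij_betw[OF permutes_imp_bij[OF that]])
    then show ?thesis by (simp add: permanent_def card_permutations)
  qed
  ultimately show ?thesis by (simp add: power_divide divide_simps)
qed


lemma equal_rows_maximize_permanent:
  obtains u :: "real ^ 'n::finite" where "norm u = 1" "\<And>i. 0 \<le> u $ i"
    "\<And>w :: real ^ 'n ^ 'n. w \<in> nonneg_unit_rows \<Longrightarrow> permanent (($) w) \<le> permanent (\<lambda>_. u)"
proof -
  let ?K = "nonneg_unit_rows :: (real ^ 'n ^ 'n) set"
  obtain w0 where w0: "w0 \<in> ?K" "\<And>w. w \<in> ?K \<Longrightarrow> permanent (($) w) \<le> permanent (($) w0)"
    using continuous_attains_sup[OF compact_nonneg_unit_rows nonneg_unit_rows_nonempty
      continuous_on_permanent] by blast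
  define M where "M = permanent (($) w0)"
  \<comment> \<open>The set of all maximizers is compact, which allows a second maximization, now of
    the length of the row sum.\<close>
  define K' where "K' = ?K \<inter> {w. permanent (($) w) = M}"
  have "closed {w :: real ^ 'n ^ 'n. permanent (($) w) = M}"
    by (intro closed_Collect_eq continuous_on_permanent continuous_intros)
  then have "compact K'"
    unfolding K'_def by (rule compact_Int_closed[OF compact_nonneg_unit_rows])
  moreover have "K' \<noteq> {}" using w0 by (auto simp: K'_def M_def)
  moreover have "continuous_on K' (\<lambda>w. (norm (\<Sum>k\<in>UNIV. w $ k))\<^sup>2)" by (intro continuous_intros)
  ultimately have "\<exists>w\<in>K'. \<forall>w'\<in>K'. (norm (\<Sum>k\<in>UNIV. w' $ k))\<^sup>2 \<le> (norm (\<Sum>k\<in>UNIV. w $ k))\<^sup>2"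
    by (rule continuous_attains_sup)
  then obtain w where w: "w \<in> K'"
    and w_max: "\<And>w'. w' \<in> K' \<Longrightarrow> (norm (\<Sum>k\<in>UNIV. w' $ k))\<^sup>2 \<le> (norm (\<Sum>k\<in>UNIV. w $ k))\<^sup>2"
    by blast
  have unit: "norm (w $ k) = 1" and nonneg: "0 \<le> w $ k $ i" for k i
    using w by (auto simp: K'_def nonneg_unit_rows_def)
  \<comment> \<open>This keeps \<open>x + y\<close> away from 0 and later gives the cross term
    \<open>s \<bullet> z\<close> its sign.\<close>
  have inner_nonneg: "0 \<le> w $ j \<bullet> w $ k" for j k
    by (simp add: inner_vec_def sum_nonneg nonneg)
  have w_perm: "permanent (($) w) = M" using w by (simp add: K'_def)
  have bound: "\<bar>permanent v\<bar> \<le> M * (\<Prod>k\<in>UNIV. norm (v k))" for v :: "'n \<Rightarrow> real ^ 'n"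
    by (rule abs_permanent_le_norms) (simp add: w0 M_def)
  have "w $ k = w $ l" for k l
  proof (rule ccontr)
    assume neq: "w $ k \<noteq> w $ l"
    then have kl: "k \<noteq> l" by auto
    define x y where "x = w $ k" and "y = w $ l"
    \<comment> \<open>With the other rows frozen, the permanent is a symmetric bilinear form in rows
      \<open>k\<close> and \<open>l\<close>.\<close>
    define B where "B u v = permanent ((($) w)(k := u, l := v))" for u v
    have B_add2: "B u (v + v') = B u v + B u v'" and B_diff2: "B u (v - v') = B u v - B u v'"
      and B_scale2: "B u (c *\<^sub>R v) = c * B u v" for u v v' c
      by (simp_all add: B_def permanent_add permanent_diff permanent_scaleR)
    \<comment> \<open>Exchanging the two updates puts row \<open>k\<close> outermost, where
      linearity applies.\<close>
    have B_add1: "B (v + v') u = B v u + B v' u" and B_diff1: "B (v - v') u = B v u - B v' u"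
      and B_scale1: "B (c *\<^sub>R v) u = c * B v u" for u v v' c
      by (simp_all add: B_def permanent_add permanent_diff permanent_scaleR fun_upd_twist[OF kl])
    have B_sym: "B u v = B v u" for u v
    proof -
      have "((($) w)(k := u, l := v)) \<circ> Transposition.transpose k l = (($) w)(k := v, l := u)"
        using kl by (auto simp: fun_eq_iff Transposition.transpose_def)
      then show ?thesis
        unfolding B_def using permanent_permute_rows[OF permutes_swap_id[of k UNIV l]]
        by (metis UNIV_I)
    qed
    have Bxy: "B x y = M" by (simp add: B_def x_def y_def w_perm)
    have B_le: "\<bar>B u u\<bar> \<le> M * (norm u)\<^sup>2" for u
    proof -
      have "(\<Prod>j\<in>UNIV. norm (((($) w)(k := u, l := u)) j)) 
          = norm u * (\<Prod>j\<in>UNIV - {l}. norm (((($) w)(k := u)) j))"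
        by (rule prod_fun_upd)
      also have "(\<Prod>j\<in>UNIV - {l}. norm (((($) w)(k := u)) j)) = 
          (\<Prod>j\<in>UNIV - {l}. if j = k then norm u else 1)"
        by (intro prod.cong) (auto simp: unit)
      also have "\<dots> = norm u" using kl by simp
      finally have rows: "(\<Prod>j\<in>UNIV. norm (((($) w)(k := u, l := u)) j)) = norm u * norm u" .
      show ?thesis
        using bound[of "(($) w)(k := u, l := u)"] by (simp only: B_def power2_eq_square rows)
    qed
    define z where "z = x + y"
    have xy: "x \<bullet> x = 1" "y \<bullet> y = 1" "0 \<le> x \<bullet> y"
      using unit inner_nonneg by (simp_all add: x_def y_def dot_square_norm)
    \<comment> \<open>\<open>d_sq\<close> is the parallelogram law for two unit vectors.\<close>
    have z_sq: "(norm z)\<^sup>2 = 2 + 2 * (x \<bullet> y)"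
      and d_sq: "(norm (x - y))\<^sup>2 = 4 - (norm z)\<^sup>2"
      unfolding z_def power2_norm_eq_inner
      using xy by (simp_all add: inner_add_left inner_add_right inner_diff_left
          inner_diff_right inner_commute)
    have "z \<noteq> 0" using z_sq xy(3) by auto
    then have z_pos: "0 < norm z" by simp
    have "0 < (norm (x - y))\<^sup>2" using neq by (simp add: x_def y_def)
    then have "(norm z)\<^sup>2 < 2\<^sup>2" using d_sq by simp
    then have z_less: "norm z < 2" by (rule power2_less_imp_less) simp
    \<comment> \<open>Polarization: \<open>4 B(x,y) = B(x+y,x+y) - B(x-y,x-y)\<close>, while \<open>|x+y|\<^sup>2 + |x-y|\<^sup>2 = 4\<close>;
      so a bilinear form attaining its norm at \<open>(x,y)\<close> also attains it at \<open>(x+y,x+y)\<close>.\<close>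
    have "B z z - B (x - y) (x - y) = 4 * M"
      using B_sym[of y x] by (simp add: z_def B_add1 B_add2 B_diff1 B_diff2 Bxy)
    moreover have "\<bar>B (x - y) (x - y)\<bar> \<le> 4 * M - M * (norm z)\<^sup>2"
      using B_le[of "x - y"] by (simp add: d_sq algebra_simps)
    ultimately have Bzz: "M * (norm z)\<^sup>2 \<le> B z z" by linarith
    define e where "e = (1 / norm z) *\<^sub>R z"
    have "B e e = B z z / (norm z)\<^sup>2"
      by (simp add: e_def B_scale1 B_scale2 power2_eq_square)
    then have Bee: "M \<le> B e e" using Bzz z_pos by (simp add: pos_le_divide_eq)
    define w' :: "real ^ 'n ^ 'n" where "w' = (\<chi> j. ((($) w)(k := e, l := e)) j)"
    have w'_nth: "($) w' = (($) w)(k := e, l := e)" by (simp add: w'_def fun_eq_iff)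
    have "norm e = 1" using z_pos by (simp add: e_def)
    moreover have "0 \<le> e $ i" for i by (simp add: e_def z_def x_def y_def nonneg)
    ultimately have "w' \<in> ?K" using unit nonneg by (simp add: nonneg_unit_rows_def w'_nth)
    moreover have "permanent (($) w') = B e e" by (simp add: w'_nth B_def)
    ultimately have "w' \<in> K'" using w0(2)[of w'] Bee by (simp add: K'_def M_def)
    then have le: "(norm (\<Sum>j\<in>UNIV. w' $ j))\<^sup>2 \<le> (norm (\<Sum>j\<in>UNIV. w $ j))\<^sup>2" by (rule w_max)
    define s where "s = (\<Sum>j\<in>UNIV - {k, l}. w $ j)"
    have split: "(\<Sum>j\<in>UNIV. f j) = f k + f l + (\<Sum>j\<in>UNIV - {k, l}. f j)"
      for f :: "'n \<Rightarrow> real ^ 'n"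
      using kl sum.subset_diff[of "{k, l}" UNIV f] by simp
    have "(\<Sum>j\<in>UNIV. w $ j) = z + s"
      by (simp only: split s_def z_def x_def y_def)
    moreover have "(\<Sum>j\<in>UNIV. w' $ j) = (2 / norm z) *\<^sub>R z + s"
    proof -
      have "(\<Sum>j\<in>UNIV - {k, l}. w' $ j) = s"
        unfolding s_def by (intro sum.cong) (auto simp: w'_nth)
      moreover have "w' $ k + w' $ l = (2 / norm z) *\<^sub>R z"
        using kl by (simp add: w'_nth e_def flip: scaleR_left.add)
      ultimately show ?thesis by (simp only: split)
    qed
    \<comment> \<open>The cases \<open>c = 1\<close> and \<open>c = 2 / norm z\<close> are the old
      and the new row sum: the part along \<open>z\<close> grows from length
      \<open>norm z < 2\<close> to 2, and the cross term does not decrease.\<close>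
    moreover have "(norm (c *\<^sub>R z + s))\<^sup>2 = (c * norm z)\<^sup>2 + 2 * c * (s \<bullet> z) + (norm s)\<^sup>2" for c
      unfolding power_mult_distrib power2_norm_eq_inner
      by (simp add: inner_add_left inner_add_right inner_commute power2_eq_square)
    from this[of 1] this[of "2 / norm z"]
    have "(norm (z + s))\<^sup>2 = (norm z)\<^sup>2 + 2 * (s \<bullet> z) + (norm s)\<^sup>2"
      "(norm ((2 / norm z) *\<^sub>R z + s))\<^sup>2 = 4 + (2 * (2 / norm z)) * (s \<bullet> z) + (norm s)\<^sup>2"
      using z_pos by simp_all
    moreover have "0 \<le> s \<bullet> z"
      by (simp add: s_def z_def x_def y_def inner_sum_left inner_add_right sum_nonneg inner_nonneg)
    then have "2 * (s \<bullet> z) \<le> (2 * (2 / norm z)) * (s \<bullet> z)"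
      using z_pos z_less by (intro mult_right_mono) (auto simp: field_simps)
    ultimately show False using le \<open>(norm z)\<^sup>2 < 2\<^sup>2\<close> by simp
  qed
  \<comment> \<open>Any index would do; \<open>undefined\<close> merely names one.\<close>
  then have "($) w = (\<lambda>_. w $ undefined)" by (simp add: fun_eq_iff)
  then have "permanent (\<lambda>_. w $ undefined) = M" using w_perm by simp
  then show thesis using that[of "w $ undefined"] unit nonneg w0(2) by (simp add: M_def)
qed

lemma abs_permanent_le_prod_norm:
  fixes w :: "'n::finite \<Rightarrow> real ^ 'n"
  shows "\<bar>permanent w\<bar> \<le> fact CARD('n) / sqrt (real CARD('n)) ^ CARD('n) * (\<Prod>k\<in>UNIV. norm (w k))"
proof -
  obtain u :: "real ^ 'n" where u: "norm u = 1" "\<And>i. 0 \<le> u $ i"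
    "\<And>w :: real ^ 'n ^ 'n. w \<in> nonneg_unit_rows \<Longrightarrow> permanent (($) w) \<le> permanent (\<lambda>_. u)"
    by (rule equal_rows_maximize_permanent) blast
  show ?thesis
    by (rule abs_permanent_le_norms) (use u permanent_const_row_le order_trans in blast)
qed

section \<open>Lower bound by duality\<close>

text \<open>This is the Hermitian pairing with \<open>per\<close>; on \<open>tensor v\<close> it is
  the permanent of the complex matrix with rows \<open>v k\<close>.\<close>

definition permutation_sum :: "('n::finite, 'n) tensor \<Rightarrow> complex" where
  "permutation_sum T = (\<Sum>\<sigma> | \<sigma> permutes UNIV. T $ \<sigma>)"

lemma permutation_sum_sum: "permutation_sum (\<Sum>i\<in>A. f i) = (\<Sum>i\<in>A. permutation_sum (f i))"
  unfolding permutation_sum_def by (simp add: sum.swap[of _ A])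

lemma per_nth: "per $ I = of_bool (I permutes UNIV)"
proof -
  have "per $ I = (\<Sum>\<sigma> | \<sigma> permutes UNIV. if I = \<sigma> then 1 else 0)"
    unfolding per_def tensor_axis[of "\<lambda>k. _ k"] by (simp add: axis_def)
  then show ?thesis by simp
qed

lemma permutation_sum_per:
  "permutation_sum (per :: ('n::finite, 'n) tensor) = fact CARD('n)"
  by (simp add: permutation_sum_def per_nth card_permutations)

text \<open>By the triangle inequality the entries can be replaced by their moduli, which keeps all
  row norms and leaves a real permanent.\<close>

lemma norm_permutation_sum_pure_le:
  fixes t :: "('n::finite, 'n) tensor"
  assumes "pure_tensor t"
  shows "norm (permutation_sum t) \<le> fact CARD('n) / sqrt (real CARD('n)) ^ CARD('n) * norm t"
proof -
  obtain v where t: "t = tensor v" using assms by (auto simp: pure_tensor_def)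
  define w :: "'n \<Rightarrow> real ^ 'n" where "w k = (\<chi> i. norm (v k $ i))" for k
  have "norm (permutation_sum t) \<le> permanent w"
    unfolding permutation_sum_def permanent_def t
    by (rule order_trans[OF norm_sum]) (simp add: tensor_def w_def prod_norm)
  also have "\<dots> \<le> fact CARD('n) / sqrt (real CARD('n)) ^ CARD('n) * (\<Prod>k\<in>UNIV. norm (w k))"
    using abs_permanent_le_prod_norm[of w] by simp
  also have "(\<Prod>k\<in>UNIV. norm (w k)) = norm t"
    unfolding t norm_tensor by (simp add: w_def norm_vec_def)
  finally show ?thesis .
qed

lemma per_decomposition_lower_bound:
  assumes "\<And>i. i < m \<Longrightarrow> pure_tensor (v i)" and "(per :: ('n::finite, 'n) tensor) = (\<Sum>i<m. v i)"
  shows "sqrt (real CARD('n)) ^ CARD('n) \<le> (\<Sum>i<m. norm (v i))"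
proof -
  let ?c = "fact CARD('n) / sqrt (real CARD('n)) ^ CARD('n) :: real"
  have "fact CARD('n) = norm (permutation_sum (per :: ('n, 'n) tensor))"
    by (simp add: permutation_sum_per)
  also have "\<dots> \<le> (\<Sum>i<m. norm (permutation_sum (v i)))"
    unfolding assms(2) permutation_sum_sum by (rule norm_sum)
  also have "\<dots> \<le> (\<Sum>i<m. ?c * norm (v i))"
    using assms(1) by (intro sum_mono norm_permutation_sum_pure_le) auto
  also have "\<dots> = fact CARD('n) * ((\<Sum>i<m. norm (v i)) / sqrt (real CARD('n)) ^ CARD('n))"
    by (simp add: sum_distrib_left sum_divide_distrib)
  finally have "1 \<le> (\<Sum>i<m. norm (v i)) / sqrt (real CARD('n)) ^ CARD('n)"
    by (simp only: mult_le_cancel_left1) simp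
  then show ?thesis by (simp add: pos_le_divide_eq)
qed

section \<open>Upper bound by Glynn's formula\<close>

text \<open>A sign vector is encoded by the set of its negative positions, so that sums range over
  the finite type \<open>'n set\<close>.\<close>

definition set_sign :: "'n set \<Rightarrow> 'n \<Rightarrow> complex" where
  "set_sign A i = (if i \<in> A then -1 else 1)"

text \<open>The sign \<open>\<delta>\<^sub>1\<dots>\<delta>\<^sub>n\<close> and the factor \<open>2\<^bsup>-n\<^esup>\<close> are distributed over the tensor factors,
  so that every summand is literally of the form \<open>tensor v\<close>.\<close>

definition glynn_vector :: "'n::finite set \<Rightarrow> 'n \<Rightarrow> complex ^ 'n" where
  "glynn_vector A k = (\<chi> i. set_sign A k * set_sign A i / 2)"

lemma norm_tensor_glynn_vector:
  "norm (tensor (glynn_vector (A :: 'n::finite set))) = sqrt (real CARD('n)) ^ CARD('n) / 2 ^ CARD('n)"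
proof -
  have "norm (glynn_vector A k) = sqrt (real CARD('n)) / 2" for k
  proof -
    have "norm (glynn_vector A k $ i) = 1 / 2" for i
      by (simp add: glynn_vector_def set_sign_def)
    then have "norm (glynn_vector A k) = L2_set (\<lambda>_. 1 / 2) (UNIV :: 'n set)"
      by (simp only: norm_vec_def)
    then show ?thesis by (simp add: L2_set_def real_sqrt_divide power_divide)
  qed
  then show ?thesis by (simp only: norm_tensor prod_constant power_divide)
qed

lemma per_eq_sum_glynn:
  "(per :: ('n::finite, 'n) tensor) = (\<Sum>A\<in>UNIV. tensor (glynn_vector A))"
proof (rule vec_eq_iff[THEN iffD2], rule allI)
  fix I :: "'n \<Rightarrow> 'n"
  define f where "f A = (\<Prod>k\<in>UNIV. set_sign A k) * (\<Prod>k\<in>UNIV. set_sign A (I k))" for A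
  have rhs: "(\<Sum>A\<in>UNIV. tensor (glynn_vector A)) $ I = (\<Sum>A\<in>UNIV. f A) / 2 ^ CARD('n)"
    by (simp add: tensor_def glynn_vector_def f_def prod.distrib prod_dividef sum_divide_distrib)
  show "per $ I = (\<Sum>A\<in>UNIV. tensor (glynn_vector A)) $ I"
  proof (cases "bij I")
    case True
    \<comment> \<open>For bijective \<open>I\<close> every sign occurs exactly twice in
      \<open>f A\<close>.\<close>
    have "f A = 1" for A
    proof -
      have "f A = (\<Prod>k\<in>UNIV. set_sign A k) * (\<Prod>k\<in>UNIV. set_sign A k)"
        using prod.reindex_bij_betw[OF True, of "set_sign A"] by (simp add: f_def)
      also have "\<dots> = 1" unfolding prod.distrib[symmetric]
        by (rule prod.neutral) (simp add: set_sign_def)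
      finally show ?thesis .
    qed
    moreover have "I permutes UNIV" using True by (rule bij_imp_permutes) simp
    ultimately show ?thesis unfolding rhs
      by (simp add: per_nth card_UNIV_set)
  next
    case False
    then have "\<not> surj I" using finite_UNIV_surj_inj[of I] by (auto simp: bij_def)
    then obtain j where j: "j \<notin> range I" by auto
    \<comment> \<open>Changing the sign at \<open>j\<close>, an index missed by \<open>I\<close>,
      negates only the first product in \<open>f A\<close>, so the summands cancel in pairs.\<close>
    define flip where "flip A = (if j \<in> A then A - {j} else insert j A)" for A
    have sign_flip: "set_sign (flip A) i = (if i = j then - set_sign A i else set_sign A i)" for A i
      by (cases "j \<in> A"; cases "i = j") (simp_all add: set_sign_def flip_def)
    have "f (flip A) = - f A" for A
    proof -
      have "(\<Prod>k\<in>UNIV. set_sign (flip A) k) = - (\<Prod>k\<in>UNIV. set_sign A k)"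
      proof -
        have "(\<Prod>k\<in>UNIV - {j}. set_sign (flip A) k) = (\<Prod>k\<in>UNIV - {j}. set_sign A k)"
          by (intro prod.cong) (auto simp: sign_flip)
        then show ?thesis by (simp add: prod.remove[of UNIV j] sign_flip)
      qed
      moreover have "set_sign (flip A) (I k) = set_sign A (I k)" for k
        using j by (auto simp: sign_flip)
      ultimately show ?thesis by (simp add: f_def)
    qed
    moreover have "bij flip"
      by (rule involuntory_imp_bij) (auto simp: flip_def)
    then have "(\<Sum>A\<in>UNIV. f (flip A)) = (\<Sum>A\<in>UNIV. f A)" by (rule sum.reindex_bij_betw)
    ultimately have "(\<Sum>A\<in>UNIV. f A) = 0" by (simp add: sum_negf)
    moreover have "\<not> I permutes UNIV" using False permutes_bij by blast
    ultimately show ?thesis unfolding rhs by (simp add: per_nth)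
  qed
qed

theorem theorem1p14:
  "nuclear_norm (per :: ('n::finite, 'n) tensor) = real CARD('n) powr (real CARD('n) / 2)"
proof -
  let ?r = "sqrt (real CARD('n)) ^ CARD('n)" and ?m = "card (UNIV :: 'n set set)"
  \<comment> \<open>Decompositions in \<open>nuclear_norm\<close> are indexed by naturals, so the
    subsets are enumerated.\<close>
  obtain h :: "nat \<Rightarrow> 'n set" where h: "bij_betw h {..<?m} UNIV"
    using ex_bij_betw_nat_finite[of "UNIV :: 'n set set"] by (auto simp: atLeast0LessThan)
  define v where "v i = tensor (glynn_vector (h i))" for i
  have "(per :: ('n, 'n) tensor) = (\<Sum>i<?m. v i)"
    unfolding per_eq_sum_glynn v_def by (rule sum.reindex_bij_betw[OF h, symmetric])
  moreover have "?r = (\<Sum>i<?m. norm (v i))"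
    by (simp add: v_def norm_tensor_glynn_vector card_UNIV_set)
  moreover have "pure_tensor (v i)" for i by (auto simp: v_def pure_tensor_def)
  ultimately have "nuclear_norm (per :: ('n, 'n) tensor) = ?r"
    unfolding nuclear_norm_def
    by (intro Least_equality) (blast intro: per_decomposition_lower_bound)+
  also have "?r = real CARD('n) powr (real CARD('n) / 2)"
    by (simp add: powr_half_sqrt[symmetric] powr_power)
  finally show ?thesis .
qed

end
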